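(* Let $(A,\mu,\Delta)$ be an $\epsilon$-bialgebra and $\alpha\colon A\to A$ be a morphism of $\epsilon$-bialgebras. Then $$A_\alpha=(A,\mu_\alpha,\Delta_\alpha,\alpha)$$ is an $\epsilon$-Hom-bialgebra, where $\mu_\alpha=\alpha\circ\mu$ and $\Delta_\alpha=\Delta\circ\alpha$.
   Context: Throughout, $\mathbf{k}$ is a fixed field of characteristic $0$; vector spaces, linear maps and tensor products are over $\mathbf{k}$. Algebras are not required to be unital and coalgebras are not required to be counital. A Hom-associative algebra $(A,\mu,\alpha)$ is a $\mathbf{k}$-vector space $A$ with a bilinear map $\mu\colon A^{\otimes 2}\to A$ and a linear map $\alpha\colon A\to A$ such that $\alpha\circ\mu=\mu\circ\alpha^{\otimes 2}$ and $\mu\circ(\alpha\otimes\mu)=\mu\circ(\mu\otimes\alpha)$. A Hom-coassociative coalgebra $(A,\Delta,\alpha)$ is a $\mathbf{k}$-vector space $A$ with linear maps $\Delta\colon A\to A^{\otimes 2}$ and $\alpha\colon A\to A$ such that $\alpha^{\otimes 2}\circ\Delta=\Delta\circ\alpha$ and $(\alpha\otimes\Delta)\circ\Delta=(\Delta\otimes\alpha)\circ\Delta$. An $\epsilon$-Hom-bialgebra (infinitesimal Hom-bialgebra) is a quadruple $(A,\mu,\Delta,\alpha)$ such that $(A,\mu,\alpha)$ is a Hom-associative algebra, $(A,\Delta,\alpha)$ is a Hom-coassociative coalgebra, and $$\Delta\circ\mu=(\mu\otimes\alpha)\circ(\alpha\otimes\Delta)+(\alpha\otimes\mu)\circ(\Delta\otimes\alpha).$$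 An $\epsilon$-bialgebra (infinitesimal bialgebra) $(A,\mu,\Delta)$ is an $\epsilon$-Hom-bialgebra with $\alpha=Id$: $(A,\mu)$ is an associative algebra, $(A,\Delta)$ is a coassociative coalgebra, and $\Delta\circ\mu=(\mu\otimes Id)\circ(Id\otimes\Delta)+(Id\otimes\mu)\circ(\Delta\otimes Id)$. A morphism of $\epsilon$-bialgebras is a linear map $f$ commuting with the multiplications and the comultiplications ($f\circ\mu=\mu\circ f^{\otimes 2}$ and $\Delta\circ f=f^{\otimes 2}\circ\Delta$). *)

theory Defs
  imports "HOL-Algebra.AbelCoset" "Jordan_Normal_Form.Missing_VectorSpace"
begin

section \<open>Tensor products of vector spaces\<close>

text \<open>
  The tensor product is the quotient of the free space on \<open>carrier M \<times> carrier N\<close> by the span of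
  the bilinearity relations. All spaces are carrier-based modules over the ring \<open>K\<close>. The
  multiplicative components \<open>mult\<close> and \<open>one\<close> of a \<^type>\<open>module\<close> record play no role
  for vector spaces and are filled in arbitrarily.
\<close>

definition free_module :: "('k, 'r) ring_scheme \<Rightarrow> 'i set \<Rightarrow> ('k, 'i \<Rightarrow> 'k) module" where
  "free_module K I = \<lparr>
     carrier = {f. (\<forall>i. f i \<in> carrier K) \<and> (\<forall>i. i \<notin> I \<longrightarrow> f i = \<zero>\<^bsub>K\<^esub>) \<and> finite {i. f i \<noteq> \<zero>\<^bsub>K\<^esub>}},
     mult = (\<lambda>f g i. \<zero>\<^bsub>K\<^esub>), one = (\<lambda>i. \<zero>\<^bsub>K\<^esub>),
     zero = (\<lambda>i. \<zero>\<^bsub>K\<^esub>),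
     add = (\<lambda>f g i. f i \<oplus>\<^bsub>K\<^esub> g i),
     smult = (\<lambda>c f i. c \<otimes>\<^bsub>K\<^esub> f i)\<rparr>"

definition free_gen :: "('k, 'r) ring_scheme \<Rightarrow> 'i \<Rightarrow> 'i \<Rightarrow> 'k" where
  "free_gen K i = (\<lambda>j. if j = i then \<one>\<^bsub>K\<^esub> else \<zero>\<^bsub>K\<^esub>)"

definition quotient_module ::
  "('k, 'm, 'x) module_scheme \<Rightarrow> 'm set \<Rightarrow> ('k, 'm set) module" where
  "quotient_module M H = \<lparr>
     carrier = a_rcosets\<^bsub>M\<^esub> H,
     mult = (\<lambda>X Y. H), one = H,
     zero = H,
     add = set_add M,
     smult = (\<lambda>c X. \<Union>x\<in>X. H +>\<^bsub>M\<^esub> (c \<odot>\<^bsub>M\<^esub> x))\<rparr>"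

type_synonym ('k, 'm, 'n) tensor = "('m \<times> 'n \<Rightarrow> 'k) set"

definition tensor_relations ::
  "('k, 'r) ring_scheme \<Rightarrow> ('k, 'm, 'x) module_scheme \<Rightarrow> ('k, 'n, 'y) module_scheme
    \<Rightarrow> ('m \<times> 'n \<Rightarrow> 'k) set" where
  "tensor_relations K M N =
     (let F = free_module K (carrier M \<times> carrier N); e = (\<lambda>x y. free_gen K (x, y)) in
      {e (x \<oplus>\<^bsub>M\<^esub> x') y \<ominus>\<^bsub>F\<^esub> (e x y \<oplus>\<^bsub>F\<^esub> e x' y) | x x' y.
         x \<in> carrier M \<and> x' \<in> carrier M \<and> y \<in> carrier N} \<union>
      {e x (y \<oplus>\<^bsub>N\<^esub> y') \<ominus>\<^bsub>F\<^esub> (e x y \<oplus>\<^bsub>F\<^esub> e x y') | x y y'.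
         x \<in> carrier M \<and> y \<in> carrier N \<and> y' \<in> carrier N} \<union>
      {e (c \<odot>\<^bsub>M\<^esub> x) y \<ominus>\<^bsub>F\<^esub> (c \<odot>\<^bsub>F\<^esub> e x y) | c x y.
         c \<in> carrier K \<and> x \<in> carrier M \<and> y \<in> carrier N} \<union>
      {e x (c \<odot>\<^bsub>N\<^esub> y) \<ominus>\<^bsub>F\<^esub> (c \<odot>\<^bsub>F\<^esub> e x y) | c x y.
         c \<in> carrier K \<and> x \<in> carrier M \<and> y \<in> carrier N})"

definition tensor_kernel ::
  "('k, 'r) ring_scheme \<Rightarrow> ('k, 'm, 'x) module_scheme \<Rightarrow> ('k, 'n, 'y) module_scheme
    \<Rightarrow> ('m \<times> 'n \<Rightarrow> 'k) set" where
  "tensor_kernel K M N =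
     LinearCombinations.module.span K (free_module K (carrier M \<times> carrier N))
       (tensor_relations K M N)"

definition tensor_product ::
  "('k, 'r) ring_scheme \<Rightarrow> ('k, 'm, 'x) module_scheme \<Rightarrow> ('k, 'n, 'y) module_scheme
    \<Rightarrow> ('k, ('k, 'm, 'n) tensor) module" where
  "tensor_product K M N =
     quotient_module (free_module K (carrier M \<times> carrier N)) (tensor_kernel K M N)"

definition pure_tensor ::
  "('k, 'r) ring_scheme \<Rightarrow> ('k, 'm, 'x) module_scheme \<Rightarrow> ('k, 'n, 'y) module_scheme
    \<Rightarrow> 'm \<Rightarrow> 'n \<Rightarrow> ('k, 'm, 'n) tensor" where
  "pure_tensor K M N x y =
     tensor_kernel K M N +>\<^bsub>free_module K (carrier M \<times> carrier N)\<^esub> free_gen K (x, y)"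

text \<open>
  The linear map out of \<open>M \<otimes> N\<close> induced by a bilinear map \<open>\<beta>\<close>: the formal sum
  \<open>f = \<Sum>\<^sub>z f(z) z\<close> is sent to \<open>\<Sum>\<^sub>z f(z) \<beta>(z)\<close>, which for bilinear \<open>\<beta>\<close> is the same for
  all representatives \<open>f\<close> of a tensor (see \<open>tensor_lift_hom\<close>, \<open>tensor_lift_pure\<close> and
  \<open>tensor_hom_eqI\<close> below for the universal property).
\<close>

definition free_lift ::
  "('k, 'r) ring_scheme \<Rightarrow> ('k, 'p, 'x) module_scheme \<Rightarrow> ('i \<Rightarrow> 'p) \<Rightarrow> ('i \<Rightarrow> 'k) \<Rightarrow> 'p" where
  "free_lift K P b f = (\<Oplus>\<^bsub>P\<^esub>i \<in> {i. f i \<noteq> \<zero>\<^bsub>K\<^esub>}. f i \<odot>\<^bsub>P\<^esub> b i)"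

definition tensor_lift ::
  "('k, 'r) ring_scheme \<Rightarrow> ('k, 'p, 'x) module_scheme \<Rightarrow> ('m \<Rightarrow> 'n \<Rightarrow> 'p)
    \<Rightarrow> ('k, 'm, 'n) tensor \<Rightarrow> 'p" where
  "tensor_lift K P \<beta> X = the_elem (free_lift K P (\<lambda>(x, y). \<beta> x y) ` X)"

text \<open>\<open>tensor_map K P Q f g : M \<otimes> N \<rightarrow> P \<otimes> Q\<close> is the map \<open>f \<otimes> g\<close>.\<close>

definition tensor_map ::
  "('k, 'r) ring_scheme \<Rightarrow> ('k, 'p, 'x) module_scheme \<Rightarrow> ('k, 'q, 'y) module_scheme
    \<Rightarrow> ('m \<Rightarrow> 'p) \<Rightarrow> ('n \<Rightarrow> 'q) \<Rightarrow> ('k, 'm, 'n) tensor \<Rightarrow> ('k, 'p, 'q) tensor" where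
  "tensor_map K P Q f g =
     tensor_lift K (tensor_product K P Q) (\<lambda>x y. pure_tensor K P Q (f x) (g y))"

text \<open>
  The canonical isomorphism \<open>(M \<otimes> N) \<otimes> P \<rightarrow> M \<otimes> (N \<otimes> P)\<close>, \<open>(x \<otimes> y) \<otimes> z \<mapsto> x \<otimes> (y \<otimes> z)\<close>, and
  its inverse, both customarily left implicit.
\<close>

definition tensor_assoc_right ::
  "('k, 'r) ring_scheme \<Rightarrow> ('k, 'm, 'x) module_scheme \<Rightarrow> ('k, 'n, 'y) module_scheme
    \<Rightarrow> ('k, 'p, 'z) module_scheme
    \<Rightarrow> ('k, ('k, 'm, 'n) tensor, 'p) tensor \<Rightarrow> ('k, 'm, ('k, 'n, 'p) tensor) tensor" where
  "tensor_assoc_right K M N P =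
     (let NP = tensor_product K N P; T = tensor_product K M NP in
      tensor_lift K T (\<lambda>t z.
        tensor_lift K T (\<lambda>x y. pure_tensor K M NP x (pure_tensor K N P y z)) t))"

definition tensor_assoc_left ::
  "('k, 'r) ring_scheme \<Rightarrow> ('k, 'm, 'x) module_scheme \<Rightarrow> ('k, 'n, 'y) module_scheme
    \<Rightarrow> ('k, 'p, 'z) module_scheme
    \<Rightarrow> ('k, 'm, ('k, 'n, 'p) tensor) tensor \<Rightarrow> ('k, ('k, 'm, 'n) tensor, 'p) tensor" where
  "tensor_assoc_left K M N P =
     (let MN = tensor_product K M N; T = tensor_product K MN P in
      tensor_lift K T (\<lambda>x t.
        tensor_lift K T (\<lambda>y z. pure_tensor K MN P (pure_tensor K M N x y) z) t))"

subsection \<open>Well-definedness and the universal property\<close>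

context cring begin

lemma free_module_module: "module R (free_module R I)"
proof (rule module_criteria)
  show "cring R" by (rule is_cring)
  show "\<forall>v w. v \<in> carrier (free_module R I) \<and> w \<in> carrier (free_module R I) \<longrightarrow>
          v \<oplus>\<^bsub>free_module R I\<^esub> w \<in> carrier (free_module R I)"
  proof (intro allI impI)
    fix v w assume vw: "v \<in> carrier (free_module R I) \<and> w \<in> carrier (free_module R I)"
    then have "finite ({i. v i \<noteq> \<zero>} \<union> {i. w i \<noteq> \<zero>})" by (simp add: free_module_def)
    then have "finite {i. v i \<oplus> w i \<noteq> \<zero>}" by (rule rev_finite_subset) auto
    with vw show "v \<oplus>\<^bsub>free_module R I\<^esub> w \<in> carrier (free_module R I)"
      by (simp add: free_module_def)
  qed
  show "\<forall>v\<in>carrier (free_module R I). \<exists>w\<in>carrier (free_module R I).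
          v \<oplus>\<^bsub>free_module R I\<^esub> w = \<zero>\<^bsub>free_module R I\<^esub>"
  proof
    fix v assume v: "v \<in> carrier (free_module R I)"
    then have "finite {i. v i \<noteq> \<zero>}" by (simp add: free_module_def)
    then have "finite {i. \<ominus> v i \<noteq> \<zero>}" by (rule rev_finite_subset) auto
    with v have "(\<lambda>i. \<ominus> v i) \<in> carrier (free_module R I)" by (simp add: free_module_def)
    moreover have "v \<oplus>\<^bsub>free_module R I\<^esub> (\<lambda>i. \<ominus> v i) = \<zero>\<^bsub>free_module R I\<^esub>"
      using v by (simp add: free_module_def r_neg)
    ultimately show "\<exists>w\<in>carrier (free_module R I).
          v \<oplus>\<^bsub>free_module R I\<^esub> w = \<zero>\<^bsub>free_module R I\<^esub>" by blast
  qed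
  show "\<forall>c v. c \<in> carrier R \<and> v \<in> carrier (free_module R I) \<longrightarrow>
          c \<odot>\<^bsub>free_module R I\<^esub> v \<in> carrier (free_module R I)"
  proof (intro allI impI)
    fix c v assume cv: "c \<in> carrier R \<and> v \<in> carrier (free_module R I)"
    then have "finite {i. v i \<noteq> \<zero>}" by (simp add: free_module_def)
    then have "finite {i. c \<otimes> v i \<noteq> \<zero>}" by (rule rev_finite_subset) (use cv in auto)
    with cv show "c \<odot>\<^bsub>free_module R I\<^esub> v \<in> carrier (free_module R I)"
      by (simp add: free_module_def)
  qed
qed (auto simp: free_module_def a_assoc a_comm a_lcomm m_assoc l_distr r_distr)

lemma free_gen_closed: "i \<in> I \<Longrightarrow> free_gen R i \<in> carrier (free_module R I)"
  by (auto simp: free_module_def free_gen_def)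

end

context module begin

lemma quotient_facts:
  assumes H: "submodule R H M"
  shows "abelian_subgroup H M"
    and "\<And>c x. c \<in> carrier R \<Longrightarrow> x \<in> carrier M \<Longrightarrow>
           c \<odot>\<^bsub>quotient_module M H\<^esub> (H +>\<^bsub>M\<^esub> x) = H +>\<^bsub>M\<^esub> (c \<odot>\<^bsub>M\<^esub> x)"
    and "module R (quotient_module M H)"
proof -
  interpret H: submodule R H M by (rule H)
  have neg: "\<ominus>\<^bsub>M\<^esub> x \<in> H" if "x \<in> H" for x
  proof -
    have "(\<ominus> \<one>) \<odot>\<^bsub>M\<^esub> x \<in> H" by (rule H.smult_closed) (use that in auto)
    then show ?thesis using subsetD[OF H.subset that] by (simp add: smult_minus_1)
  qed
  have "additive_subgroup H M"
    by (rule additive_subgroup.intro, rule subgroup.intro)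
       (use H.subset neg in \<open>auto simp: a_inv_def\<close>)
  then show sub: "abelian_subgroup H M"
    by (rule abelian_subgroupI3) (rule abelian_group_axioms)
  interpret S: abelian_subgroup H M by (rule sub)
  have coset_sub: "x \<in> H +>\<^bsub>M\<^esub> x" if "x \<in> carrier M" for x
    using that S.a_rcos_self by blast
  have smult: "c \<odot>\<^bsub>quotient_module M H\<^esub> (H +>\<^bsub>M\<^esub> x) = H +>\<^bsub>M\<^esub> (c \<odot>\<^bsub>M\<^esub> x)"
    if c: "c \<in> carrier R" and x: "x \<in> carrier M" for c x
  proof -
    have "H +>\<^bsub>M\<^esub> (c \<odot>\<^bsub>M\<^esub> y) = H +>\<^bsub>M\<^esub> (c \<odot>\<^bsub>M\<^esub> x)" if y: "y \<in> H +>\<^bsub>M\<^esub> x" for y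
    proof -
      obtain h where h: "h \<in> H" "y = h \<oplus>\<^bsub>M\<^esub> x" using y by (auto simp: a_r_coset_def')
      then have "c \<odot>\<^bsub>M\<^esub> y = c \<odot>\<^bsub>M\<^esub> h \<oplus>\<^bsub>M\<^esub> c \<odot>\<^bsub>M\<^esub> x"
        using c x H.subset by (auto simp: smult_r_distr)
      then have "c \<odot>\<^bsub>M\<^esub> y \<in> H +>\<^bsub>M\<^esub> (c \<odot>\<^bsub>M\<^esub> x)"
        using h c by (auto simp: a_r_coset_def')
      then show ?thesis using c x by (metis S.a_repr_independence' smult_closed)
    qed
    then have "(\<Union>y\<in>H +>\<^bsub>M\<^esub> x. H +>\<^bsub>M\<^esub> (c \<odot>\<^bsub>M\<^esub> y)) = (\<Union>y\<in>H +>\<^bsub>M\<^esub> x. H +>\<^bsub>M\<^esub> (c \<odot>\<^bsub>M\<^esub> x))"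
      by (rule SUP_cong[OF refl])
    moreover have "H +>\<^bsub>M\<^esub> x \<noteq> {}" using coset_sub[OF x] by blast
    ultimately show ?thesis unfolding quotient_module_def by simp
  qed
  then show "\<And>c x. c \<in> carrier R \<Longrightarrow> x \<in> carrier M \<Longrightarrow>
           c \<odot>\<^bsub>quotient_module M H\<^esub> (H +>\<^bsub>M\<^esub> x) = H +>\<^bsub>M\<^esub> (c \<odot>\<^bsub>M\<^esub> x)" .
  have add: "(H +>\<^bsub>M\<^esub> x) \<oplus>\<^bsub>quotient_module M H\<^esub> (H +>\<^bsub>M\<^esub> y) = H +>\<^bsub>M\<^esub> (x \<oplus>\<^bsub>M\<^esub> y)"
    if "x \<in> carrier M" "y \<in> carrier M" for x y
    using that S.a_rcos_sum by (simp add: quotient_module_def)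
  have car: "carrier (quotient_module M H) = (\<lambda>x. H +>\<^bsub>M\<^esub> x) ` carrier M"
    by (auto simp: quotient_module_def A_RCOSETS_def RCOSETS_def a_r_coset_def)
  have zero: "\<zero>\<^bsub>quotient_module M H\<^esub> = H +>\<^bsub>M\<^esub> \<zero>\<^bsub>M\<^esub>"
    using S.a_rcos_const[OF H.zero_closed] by (simp add: quotient_module_def)
  have neg': "\<exists>z\<in>carrier M. H +>\<^bsub>M\<^esub> (y \<oplus>\<^bsub>M\<^esub> z) = H +>\<^bsub>M\<^esub> \<zero>\<^bsub>M\<^esub>" if "y \<in> carrier M" for y
    using that by (intro bexI[of _ "\<ominus>\<^bsub>M\<^esub> y"]) (auto simp: M.r_neg)
  show "module R (quotient_module M H)"
    by (rule module_criteria)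
       (auto simp: car add smult zero M.a_assoc M.a_comm M.a_lcomm smult_l_distr smult_r_distr smult_assoc1
          neg' is_cring)
qed

end

context
  fixes K :: "('k, 'r) ring_scheme" and M :: "('k, 'm, 'x) module_scheme"
    and N :: "('k, 'n, 'y) module_scheme"
  assumes M: "module K M" and N: "module K N"
begin

interpretation K: cring K using M by (simp add: module_def)
interpretation M: module K M by (rule M)
interpretation N: module K N by (rule N)

private abbreviation "F \<equiv> free_module K (carrier M \<times> carrier N)"

interpretation F: module K F by (rule K.free_module_module)

private lemma gen_closed: "x \<in> carrier M \<Longrightarrow> y \<in> carrier N \<Longrightarrow> free_gen K (x, y) \<in> carrier F"
  by (simp add: K.free_gen_closed)

lemma tensor_relations_closed: "tensor_relations K M N \<subseteq> carrier F"
  by (auto simp: tensor_relations_def Let_def intro!: F.M.minus_closed F.M.a_closed F.smult_closed gen_closed)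

lemma tensor_kernel_submodule: "submodule K (tensor_kernel K M N) F"
  unfolding tensor_kernel_def by (rule F.span_is_submodule[OF tensor_relations_closed])

lemma tensor_product_module: "module K (tensor_product K M N)"
  unfolding tensor_product_def by (rule F.quotient_facts(3)[OF tensor_kernel_submodule])

interpretation S: abelian_subgroup "tensor_kernel K M N" F
  by (rule F.quotient_facts(1)[OF tensor_kernel_submodule])

private abbreviation cos where "cos f \<equiv> tensor_kernel K M N +>\<^bsub>F\<^esub> f"

lemma tensor_carrier: "carrier (tensor_product K M N) = cos ` carrier F"
  by (auto simp: tensor_product_def quotient_module_def A_RCOSETS_def RCOSETS_def a_r_coset_def)

lemma tensor_add: "f \<in> carrier F \<Longrightarrow> g \<in> carrier F \<Longrightarrow>
    cos f \<oplus>\<^bsub>tensor_product K M N\<^esub> cos g = cos (f \<oplus>\<^bsub>F\<^esub> g)"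
  using S.a_rcos_sum by (simp add: tensor_product_def quotient_module_def)

lemma tensor_smult: "c \<in> carrier K \<Longrightarrow> f \<in> carrier F \<Longrightarrow>
    c \<odot>\<^bsub>tensor_product K M N\<^esub> cos f = cos (c \<odot>\<^bsub>F\<^esub> f)"
  using F.quotient_facts(2)[OF tensor_kernel_submodule] by (simp add: tensor_product_def)

lemma pure_tensor_closed:
  "x \<in> carrier M \<Longrightarrow> y \<in> carrier N \<Longrightarrow> pure_tensor K M N x y \<in> carrier (tensor_product K M N)"
  by (auto simp: tensor_carrier pure_tensor_def gen_closed)

private lemma relation_eq:
  assumes "f \<ominus>\<^bsub>F\<^esub> g \<in> tensor_relations K M N" "f \<in> carrier F" "g \<in> carrier F"
  shows "cos f = cos g"
proof -
  have "f \<ominus>\<^bsub>F\<^esub> g \<in> tensor_kernel K M N"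
    using assms(1) F.in_own_span[OF tensor_relations_closed] unfolding tensor_kernel_def by blast
  then have "f \<in> cos g" using assms S.a_rcos_module by (simp add: a_minus_def)
  then show ?thesis using assms(3) S.a_subgroup by (metis S.a_repr_independence')
qed

lemma pure_tensor_bilinear:
  assumes "x \<in> carrier M" "y \<in> carrier N"
  shows "x' \<in> carrier M \<Longrightarrow> pure_tensor K M N (x \<oplus>\<^bsub>M\<^esub> x') y =
      pure_tensor K M N x y \<oplus>\<^bsub>tensor_product K M N\<^esub> pure_tensor K M N x' y"
    and "y' \<in> carrier N \<Longrightarrow> pure_tensor K M N x (y \<oplus>\<^bsub>N\<^esub> y') =
      pure_tensor K M N x y \<oplus>\<^bsub>tensor_product K M N\<^esub> pure_tensor K M N x y'"
    and "c \<in> carrier K \<Longrightarrow> pure_tensor K M N (c \<odot>\<^bsub>M\<^esub> x) y =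
      c \<odot>\<^bsub>tensor_product K M N\<^esub> pure_tensor K M N x y"
    and "c \<in> carrier K \<Longrightarrow> pure_tensor K M N x (c \<odot>\<^bsub>N\<^esub> y) =
      c \<odot>\<^bsub>tensor_product K M N\<^esub> pure_tensor K M N x y"
proof -
  note rel = tensor_relations_def[of K M N, unfolded Let_def]
  show "pure_tensor K M N (x \<oplus>\<^bsub>M\<^esub> x') y =
      pure_tensor K M N x y \<oplus>\<^bsub>tensor_product K M N\<^esub> pure_tensor K M N x' y" if "x' \<in> carrier M"
  proof -
    have "cos (free_gen K (x \<oplus>\<^bsub>M\<^esub> x', y)) = cos (free_gen K (x, y) \<oplus>\<^bsub>F\<^esub> free_gen K (x', y))"
      by (rule relation_eq, unfold rel, use assms that in blast) (simp_all add: assms that gen_closed)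
    then show ?thesis by (simp add: pure_tensor_def tensor_add gen_closed assms that)
  qed
  show "pure_tensor K M N x (y \<oplus>\<^bsub>N\<^esub> y') =
      pure_tensor K M N x y \<oplus>\<^bsub>tensor_product K M N\<^esub> pure_tensor K M N x y'" if "y' \<in> carrier N"
  proof -
    have "cos (free_gen K (x, y \<oplus>\<^bsub>N\<^esub> y')) = cos (free_gen K (x, y) \<oplus>\<^bsub>F\<^esub> free_gen K (x, y'))"
      by (rule relation_eq, unfold rel, use assms that in blast) (simp_all add: assms that gen_closed)
    then show ?thesis by (simp add: pure_tensor_def tensor_add gen_closed assms that)
  qed
  show "pure_tensor K M N (c \<odot>\<^bsub>M\<^esub> x) y =
      c \<odot>\<^bsub>tensor_product K M N\<^esub> pure_tensor K M N x y" if "c \<in> carrier K"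
  proof -
    have "cos (free_gen K (c \<odot>\<^bsub>M\<^esub> x, y)) = cos (c \<odot>\<^bsub>F\<^esub> free_gen K (x, y))"
      by (rule relation_eq, unfold rel, use assms that in blast) (simp_all add: assms that gen_closed)
    then show ?thesis by (simp add: pure_tensor_def tensor_smult gen_closed assms that)
  qed
  show "pure_tensor K M N x (c \<odot>\<^bsub>N\<^esub> y) =
      c \<odot>\<^bsub>tensor_product K M N\<^esub> pure_tensor K M N x y" if "c \<in> carrier K"
  proof -
    have "cos (free_gen K (x, c \<odot>\<^bsub>N\<^esub> y)) = cos (c \<odot>\<^bsub>F\<^esub> free_gen K (x, y))"
      by (rule relation_eq, unfold rel, use assms that in blast) (simp_all add: assms that gen_closed)
    then show ?thesis by (simp add: pure_tensor_def tensor_smult gen_closed assms that)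
  qed
qed

context
  fixes P :: "('k, 'p, 'z) module_scheme" and \<beta> :: "'m \<Rightarrow> 'n \<Rightarrow> 'p"
  assumes P: "module K P"
    and closed: "\<And>x y. x \<in> carrier M \<Longrightarrow> y \<in> carrier N \<Longrightarrow> \<beta> x y \<in> carrier P"
    and add_left: "\<And>x x' y. x \<in> carrier M \<Longrightarrow> x' \<in> carrier M \<Longrightarrow> y \<in> carrier N \<Longrightarrow>
          \<beta> (x \<oplus>\<^bsub>M\<^esub> x') y = \<beta> x y \<oplus>\<^bsub>P\<^esub> \<beta> x' y"
    and add_right: "\<And>x y y'. x \<in> carrier M \<Longrightarrow> y \<in> carrier N \<Longrightarrow> y' \<in> carrier N \<Longrightarrow>
          \<beta> x (y \<oplus>\<^bsub>N\<^esub> y') = \<beta> x y \<oplus>\<^bsub>P\<^esub> \<beta> x y'"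
    and smult_left: "\<And>c x y. c \<in> carrier K \<Longrightarrow> x \<in> carrier M \<Longrightarrow> y \<in> carrier N \<Longrightarrow>
          \<beta> (c \<odot>\<^bsub>M\<^esub> x) y = c \<odot>\<^bsub>P\<^esub> \<beta> x y"
    and smult_right: "\<And>c x y. c \<in> carrier K \<Longrightarrow> x \<in> carrier M \<Longrightarrow> y \<in> carrier N \<Longrightarrow>
          \<beta> x (c \<odot>\<^bsub>N\<^esub> y) = c \<odot>\<^bsub>P\<^esub> \<beta> x y"
begin

interpretation P: module K P by (rule P)

private abbreviation ev where "ev \<equiv> free_lift K P (\<lambda>(x, y). \<beta> x y)"

private lemma value_closed: "i \<in> carrier M \<times> carrier N \<Longrightarrow> (case i of (x, y) \<Rightarrow> \<beta> x y) \<in> carrier P"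
  by (auto simp: closed)

private lemma term_closed:
  assumes "i \<in> carrier M \<times> carrier N" "f \<in> carrier F"
  shows "f i \<odot>\<^bsub>P\<^esub> (case i of (x, y) \<Rightarrow> \<beta> x y) \<in> carrier P"
proof -
  have "f i \<in> carrier K" using assms(2) by (simp add: free_module_def del: split_paired_All)
  then show ?thesis using value_closed[OF assms(1)] by (rule P.smult_closed)
qed

private lemma ev_eq:
  assumes f: "f \<in> carrier F" and A: "finite A" "{i. f i \<noteq> \<zero>\<^bsub>K\<^esub>} \<subseteq> A" "A \<subseteq> carrier M \<times> carrier N"
  shows "ev f = (\<Oplus>\<^bsub>P\<^esub>i\<in>A. f i \<odot>\<^bsub>P\<^esub> (case i of (x, y) \<Rightarrow> \<beta> x y))"
  unfolding free_lift_def
  by (rule P.add.finprod_mono_neutral_cong_left)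
     (use A closed term_closed[OF _ f] in \<open>auto simp: P.smult_l_null\<close>)

private lemma supp: "f \<in> carrier F \<Longrightarrow> finite {i. f i \<noteq> \<zero>\<^bsub>K\<^esub>}"
  "f \<in> carrier F \<Longrightarrow> {i. f i \<noteq> \<zero>\<^bsub>K\<^esub>} \<subseteq> carrier M \<times> carrier N"
  by (auto simp: free_module_def)

private lemma ev_closed: "f \<in> carrier F \<Longrightarrow> ev f \<in> carrier P"
  unfolding free_lift_def by (rule P.M.finsum_closed) (use supp(2) term_closed in blast)

private lemma ev_add:
  assumes f: "f \<in> carrier F" and g: "g \<in> carrier F"
  shows "ev (f \<oplus>\<^bsub>F\<^esub> g) = ev f \<oplus>\<^bsub>P\<^esub> ev g"
proof -
  let ?A = "{i. f i \<noteq> \<zero>\<^bsub>K\<^esub>} \<union> {i. g i \<noteq> \<zero>\<^bsub>K\<^esub>}"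
  have A: "finite ?A" "?A \<subseteq> carrier M \<times> carrier N" using supp f g by auto
  have s: "{i. (f \<oplus>\<^bsub>F\<^esub> g) i \<noteq> \<zero>\<^bsub>K\<^esub>} \<subseteq> ?A" by (auto simp: free_module_def)
  have fg: "f i \<in> carrier K" "g i \<in> carrier K" for i using f g by (simp_all add: free_module_def del: split_paired_All)
  have b: "(case i of (x, y) \<Rightarrow> \<beta> x y) \<in> carrier P" if "i \<in> ?A" for i
    by (rule value_closed[OF subsetD[OF A(2) that]])
  have "ev (f \<oplus>\<^bsub>F\<^esub> g) = (\<Oplus>\<^bsub>P\<^esub>i\<in>?A. (f \<oplus>\<^bsub>F\<^esub> g) i \<odot>\<^bsub>P\<^esub> (case i of (x, y) \<Rightarrow> \<beta> x y))"
    by (rule ev_eq) (use f g A s in auto)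
  also have "\<dots> = (\<Oplus>\<^bsub>P\<^esub>i\<in>?A. f i \<odot>\<^bsub>P\<^esub> (case i of (x, y) \<Rightarrow> \<beta> x y) \<oplus>\<^bsub>P\<^esub> g i \<odot>\<^bsub>P\<^esub> (case i of (x, y) \<Rightarrow> \<beta> x y))"
    by (rule P.M.finsum_cong')
       (use b fg in \<open>auto simp: free_module_def P.smult_l_distr\<close>)
  also have "\<dots> = (\<Oplus>\<^bsub>P\<^esub>i\<in>?A. f i \<odot>\<^bsub>P\<^esub> (case i of (x, y) \<Rightarrow> \<beta> x y)) \<oplus>\<^bsub>P\<^esub> (\<Oplus>\<^bsub>P\<^esub>i\<in>?A. g i \<odot>\<^bsub>P\<^esub> (case i of (x, y) \<Rightarrow> \<beta> x y))"
    by (rule P.M.finsum_addf) (use b fg in auto)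
  also have "\<dots> = ev f \<oplus>\<^bsub>P\<^esub> ev g"
    using ev_eq[OF f A(1) _ A(2)] ev_eq[OF g A(1) _ A(2)] by simp
  finally show ?thesis .
qed

private lemma ev_smult:
  assumes f: "f \<in> carrier F" and c: "c \<in> carrier K"
  shows "ev (c \<odot>\<^bsub>F\<^esub> f) = c \<odot>\<^bsub>P\<^esub> ev f"
proof -
  let ?A = "{i. f i \<noteq> \<zero>\<^bsub>K\<^esub>}"
  have A: "finite ?A" "?A \<subseteq> carrier M \<times> carrier N" using supp f by auto
  have s: "{i. (c \<odot>\<^bsub>F\<^esub> f) i \<noteq> \<zero>\<^bsub>K\<^esub>} \<subseteq> ?A" using c by (auto simp: free_module_def)
  have fg: "f i \<in> carrier K" for i using f by (simp add: free_module_def del: split_paired_All)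
  have b: "(case i of (x, y) \<Rightarrow> \<beta> x y) \<in> carrier P" if "i \<in> ?A" for i
    by (rule value_closed[OF subsetD[OF A(2) that]])
  have "ev (c \<odot>\<^bsub>F\<^esub> f) = (\<Oplus>\<^bsub>P\<^esub>i\<in>?A. (c \<odot>\<^bsub>F\<^esub> f) i \<odot>\<^bsub>P\<^esub> (case i of (x, y) \<Rightarrow> \<beta> x y))"
    by (rule ev_eq) (use f c A s in auto)
  also have "\<dots> = (\<Oplus>\<^bsub>P\<^esub>i\<in>?A. c \<odot>\<^bsub>P\<^esub> (f i \<odot>\<^bsub>P\<^esub> (case i of (x, y) \<Rightarrow> \<beta> x y)))"
    by (rule P.M.finsum_cong')
       (use b fg c in \<open>auto simp: free_module_def P.smult_assoc1\<close>)
  also have "\<dots> = c \<odot>\<^bsub>P\<^esub> ev f"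
    unfolding free_lift_def
    by (rule P.finsum_smult_ldistr[symmetric]) (use A b fg c in auto)
  finally show ?thesis .
qed

private lemma ev_hom: "mod_hom K F P ev"
  using ev_closed ev_add ev_smult
  by (auto simp: mod_hom_def mod_hom_axioms_def module_hom_def F.module_axioms P)

interpretation ev: mod_hom K F P ev by (rule ev_hom)

private lemma ev_gen:
  assumes "x \<in> carrier M" "y \<in> carrier N" shows "ev (free_gen K (x, y)) = \<beta> x y"
proof -
  have "ev (free_gen K (x, y)) = (\<Oplus>\<^bsub>P\<^esub>i\<in>{(x, y)}. free_gen K (x, y) i \<odot>\<^bsub>P\<^esub> (case i of (x, y) \<Rightarrow> \<beta> x y))"
    by (rule ev_eq) (use assms gen_closed[OF assms] in \<open>auto simp: free_gen_def split: if_splits\<close>)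
  also have "\<dots> = \<beta> x y" using closed[OF assms]
    by (simp add: P.M.add.finprod_insert free_gen_def P.M.finsum_empty)
  finally show ?thesis .
qed

private lemma ev_kernel: "f \<in> tensor_kernel K M N \<Longrightarrow> ev f = \<zero>\<^bsub>P\<^esub>"
proof -
  have "tensor_relations K M N \<subseteq> ev.ker"
    by (auto simp: tensor_relations_def Let_def ev.ker_def gen_closed ev_gen closed
          add_left add_right smult_left smult_right P.M.minus_eq P.M.r_neg)
  then have "tensor_kernel K M N \<subseteq> ev.ker"
    unfolding tensor_kernel_def by (rule F.span_is_subset[OF _ ev.ker_is_submodule])
  then show "f \<in> tensor_kernel K M N \<Longrightarrow> ev f = \<zero>\<^bsub>P\<^esub>" by (auto simp: ev.ker_def)
qed

private lemma tensor_lift_coset: "f \<in> carrier F \<Longrightarrow> tensor_lift K P \<beta> (cos f) = ev f"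
proof -
  assume f: "f \<in> carrier F"
  have "ev g = ev f" if g: "g \<in> cos f" for g
  proof -
    obtain h where h: "h \<in> tensor_kernel K M N" "g = h \<oplus>\<^bsub>F\<^esub> f" using g by (auto simp: a_r_coset_def')
    then have "h \<in> carrier F" using S.a_subset by auto
    with h f show ?thesis by (simp add: ev_add ev_kernel ev_closed)
  qed
  moreover have "f \<in> cos f" using f S.a_rcos_self by blast
  ultimately have "ev ` cos f = {ev f}" by blast
  then show ?thesis by (simp add: tensor_lift_def)
qed

lemma tensor_lift_hom: "tensor_lift K P \<beta> \<in> module_hom K (tensor_product K M N) P"
  by (auto simp: module_hom_def tensor_carrier tensor_add tensor_smult tensor_lift_coset
      ev_closed ev_add ev_smult)

lemma tensor_lift_pure:
  "x \<in> carrier M \<Longrightarrow> y \<in> carrier N \<Longrightarrow> tensor_lift K P \<beta> (pure_tensor K M N x y) = \<beta> x y"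
  by (simp add: pure_tensor_def tensor_lift_coset gen_closed ev_gen)

end

lemma tensor_hom_eqI:
  fixes P :: "('k, 'p, 'z) module_scheme"
  assumes P: "module K P"
    and g: "g \<in> module_hom K (tensor_product K M N) P"
    and h: "h \<in> module_hom K (tensor_product K M N) P"
    and eq: "\<And>x y. x \<in> carrier M \<Longrightarrow> y \<in> carrier N \<Longrightarrow>
        g (pure_tensor K M N x y) = h (pure_tensor K M N x y)"
    and t: "t \<in> carrier (tensor_product K M N)"
  shows "g t = h t"
proof -
  interpret g: mod_hom K "tensor_product K M N" P g
    by (simp add: mod_hom_def mod_hom_axioms_def P g tensor_product_module)
  interpret h: mod_hom K "tensor_product K M N" P h
    by (simp add: mod_hom_def mod_hom_axioms_def P h tensor_product_module)
  have "g (cos f) = h (cos f)" if "finite A" "f \<in> carrier F" "{i. f i \<noteq> \<zero>\<^bsub>K\<^esub>} \<subseteq> A" for A f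
    using that
  proof (induction A arbitrary: f)
    case empty
    then have "f = \<zero>\<^bsub>F\<^esub>" by (auto simp: free_module_def)
    then have "cos f = \<zero>\<^bsub>tensor_product K M N\<^esub>"
      using S.a_rcos_const[OF S.zero_closed] by (simp add: tensor_product_def quotient_module_def)
    then show ?case by simp
  next
    case (insert i A)
    show ?case
    proof (cases "f i = \<zero>\<^bsub>K\<^esub>")
      case True
      then have "{i. f i \<noteq> \<zero>\<^bsub>K\<^esub>} \<subseteq> A" using insert.prems by blast
      then show ?thesis using insert by blast
    next
      case False
      obtain x y where i: "i = (x, y)" "x \<in> carrier M" "y \<in> carrier N"
        using insert.prems(1) False by (cases i) (auto simp: free_module_def)
      define f' where "f' = f(i := \<zero>\<^bsub>K\<^esub>)"
      have fK: "f j \<in> carrier K" for j using insert.prems(1) by (simp add: free_module_def del: split_paired_All)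
      have "finite {j. f' j \<noteq> \<zero>\<^bsub>K\<^esub>}"
        by (rule finite_subset[of _ "{j. f j \<noteq> \<zero>\<^bsub>K\<^esub>}"])
           (use insert.prems in \<open>auto simp: f'_def free_module_def\<close>)
      then have f': "f' \<in> carrier F" using insert.prems(1) by (simp add: f'_def free_module_def)
      have "{j. f' j \<noteq> \<zero>\<^bsub>K\<^esub>} \<subseteq> A" using insert.prems by (auto simp: f'_def)
      then have IH: "g (cos f') = h (cos f')" using insert.IH f' by blast
      have "f = f' \<oplus>\<^bsub>F\<^esub> (f i \<odot>\<^bsub>F\<^esub> free_gen K i)"
        using fK by (auto simp: fun_eq_iff f'_def free_module_def free_gen_def)
      moreover have G: "free_gen K i \<in> carrier F" using i gen_closed by simp
      ultimately have "cos f = cos f' \<oplus>\<^bsub>tensor_product K M N\<^esub>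
          (f i \<odot>\<^bsub>tensor_product K M N\<^esub> pure_tensor K M N x y)"
        using tensor_add[OF f' F.smult_closed[OF fK G]] tensor_smult[OF fK G] i
        by (simp add: pure_tensor_def)
      moreover have "cos f' \<in> carrier (tensor_product K M N)" using f' tensor_carrier by blast
      ultimately show ?thesis
        using IH eq i fK pure_tensor_closed[of x y] g.N.module_axioms
          module.smult_closed[OF tensor_product_module, of "f i" "pure_tensor K M N x y"] by simp
    qed
  qed
  moreover obtain f where "f \<in> carrier F" "t = cos f" using t tensor_carrier by auto
  ultimately show ?thesis by (auto simp: free_module_def)
qed

end


section \<open>Infinitesimal Hom-bialgebras\<close>

text \<open>
  Neither units nor counits are required. The identities between maps on threefold tensor powers
  are stated on \<open>A \<otimes> (A \<otimes> A)\<close> and \<open>(A \<otimes> A) \<otimes> A\<close> with the canonical isomorphisms inserted, and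
  equality of linear maps means agreement on the carrier of their domain.
\<close>

locale hom_associative_algebra = vectorspace K A
  for K :: "('k, 'r) ring_scheme" and A :: "('k, 'a, 'm) module_scheme" +
  fixes \<mu> :: "('k, 'a, 'a) tensor \<Rightarrow> 'a" and \<alpha> :: "'a \<Rightarrow> 'a"
  assumes mult_linear: "\<mu> \<in> module_hom K (tensor_product K A A) A"
    and twist_linear: "\<alpha> \<in> module_hom K A A"
    and twist_mult:
      "\<And>t. t \<in> carrier (tensor_product K A A) \<Longrightarrow> \<alpha> (\<mu> t) = \<mu> (tensor_map K A A \<alpha> \<alpha> t)"
    and hom_assoc:
      "\<And>t. t \<in> carrier (tensor_product K A (tensor_product K A A)) \<Longrightarrow>
         \<mu> (tensor_map K A A \<alpha> \<mu> t) = \<mu> (tensor_map K A A \<mu> \<alpha> (tensor_assoc_left K A A A t))"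

locale hom_coassociative_coalgebra = vectorspace K A
  for K :: "('k, 'r) ring_scheme" and A :: "('k, 'a, 'm) module_scheme" +
  fixes \<Delta> :: "'a \<Rightarrow> ('k, 'a, 'a) tensor" and \<alpha> :: "'a \<Rightarrow> 'a"
  assumes comult_linear: "\<Delta> \<in> module_hom K A (tensor_product K A A)"
    and twist_linear': "\<alpha> \<in> module_hom K A A"
    and twist_comult: "\<And>x. x \<in> carrier A \<Longrightarrow> tensor_map K A A \<alpha> \<alpha> (\<Delta> x) = \<Delta> (\<alpha> x)"
    and hom_coassoc:
      "\<And>x. x \<in> carrier A \<Longrightarrow>
         tensor_assoc_left K A A A (tensor_map K A (tensor_product K A A) \<alpha> \<Delta> (\<Delta> x)) =
         tensor_map K (tensor_product K A A) A \<Delta> \<alpha> (\<Delta> x)"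

locale infinitesimal_hom_bialgebra =
  hom_associative_algebra K A \<mu> \<alpha> + hom_coassociative_coalgebra K A \<Delta> \<alpha>
  for K :: "('k, 'r) ring_scheme" and A :: "('k, 'a, 'm) module_scheme" and \<mu> \<Delta> \<alpha> +
  assumes comult_mult:
    "\<And>t. t \<in> carrier (tensor_product K A A) \<Longrightarrow>
       \<Delta> (\<mu> t) =
         tensor_map K A A \<mu> \<alpha>
           (tensor_assoc_left K A A A (tensor_map K A (tensor_product K A A) \<alpha> \<Delta> t))
         \<oplus>\<^bsub>tensor_product K A A\<^esub>
         tensor_map K A A \<alpha> \<mu>
           (tensor_assoc_right K A A A (tensor_map K (tensor_product K A A) A \<Delta> \<alpha> t))"

locale infinitesimal_bialgebra = infinitesimal_hom_bialgebra K A \<mu> \<Delta> id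
  for K :: "('k, 'r) ring_scheme" and A :: "('k, 'a, 'm) module_scheme" and \<mu> \<Delta>

locale infinitesimal_bialgebra_morphism =
  dom: infinitesimal_bialgebra K A \<mu>\<^sub>A \<Delta>\<^sub>A + cod: infinitesimal_bialgebra K B \<mu>\<^sub>B \<Delta>\<^sub>B
  for K :: "('k, 'r) ring_scheme"
    and A :: "('k, 'a, 'm) module_scheme" and \<mu>\<^sub>A \<Delta>\<^sub>A
    and B :: "('k, 'b, 'n) module_scheme" and \<mu>\<^sub>B \<Delta>\<^sub>B +
  fixes f :: "'a \<Rightarrow> 'b"
  assumes linear: "f \<in> module_hom K A B"
    and mult:
      "\<And>t. t \<in> carrier (tensor_product K A A) \<Longrightarrow> f (\<mu>\<^sub>A t) = \<mu>\<^sub>B (tensor_map K B B f f t)"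
    and comult: "\<And>x. x \<in> carrier A \<Longrightarrow> \<Delta>\<^sub>B (f x) = tensor_map K B B f f (\<Delta>\<^sub>A x)"

end

theory Submission
  imports Defs
begin

text \<open>
  Since \<open>\<alpha>\<close> commutes with \<open>\<mu>\<close> and \<open>\<Delta>\<close>, all twists can be moved to the outside: functoriality
  of the tensor product gives
  \<open>\<alpha> \<otimes> (\<alpha> \<circ> \<mu>) = (\<alpha> \<otimes> \<alpha>) \<circ> (id \<otimes> \<mu>)\<close> and \<open>\<alpha> \<otimes> (\<Delta> \<circ> \<alpha>) = (id \<otimes> \<Delta>) \<circ> (\<alpha> \<otimes> \<alpha>)\<close>, and similarly
  with the factors exchanged. Each twisted axiom is then the untwisted one composed with powers
  of \<open>\<alpha>\<close> or \<open>\<alpha> \<otimes> \<alpha>\<close>; no naturality of the associativity isomorphisms is needed because the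
  twists never have to cross them.
\<close>

section \<open>Module homomorphisms and bilinear maps\<close>

lemma module_hom_comp:
  "f \<in> module_hom K M N \<Longrightarrow> g \<in> module_hom K N P \<Longrightarrow> g \<circ> f \<in> module_hom K M P"
  by (auto simp: module_hom_def Pi_iff)

lemma module_hom_id: "id \<in> module_hom K M M"
  by (auto simp: module_hom_def)

lemma module_hom_closed: "f \<in> module_hom K M N \<Longrightarrow> x \<in> carrier M \<Longrightarrow> f x \<in> carrier N"
  by (auto simp: module_hom_def)

lemma module_hom_add:
  "f \<in> module_hom K M N \<Longrightarrow> x \<in> carrier M \<Longrightarrow> y \<in> carrier M \<Longrightarrow>
    f (x \<oplus>\<^bsub>M\<^esub> y) = f x \<oplus>\<^bsub>N\<^esub> f y"
  by (auto simp: module_hom_def)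

lemma module_hom_smult:
  "f \<in> module_hom K M N \<Longrightarrow> c \<in> carrier K \<Longrightarrow> x \<in> carrier M \<Longrightarrow>
    f (c \<odot>\<^bsub>M\<^esub> x) = c \<odot>\<^bsub>N\<^esub> f x"
  by (auto simp: module_hom_def)

lemmas module_hom_simps = module_hom_closed module_hom_add module_hom_smult

lemma module_homI:
  assumes "\<And>x. x \<in> carrier M \<Longrightarrow> f x \<in> carrier N"
    and "\<And>x y. x \<in> carrier M \<Longrightarrow> y \<in> carrier M \<Longrightarrow> f (x \<oplus>\<^bsub>M\<^esub> y) = f x \<oplus>\<^bsub>N\<^esub> f y"
    and "\<And>c x. c \<in> carrier K \<Longrightarrow> x \<in> carrier M \<Longrightarrow> f (c \<odot>\<^bsub>M\<^esub> x) = c \<odot>\<^bsub>N\<^esub> f x"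
  shows "f \<in> module_hom K M N"
  using assms by (auto simp: module_hom_def)

text \<open>Together with \<open>module_hom_scale\<close>, this makes the right-hand sides in
  \<open>tensor_lift_param_hom\<close> linear in the tensor, so that pure tensors decide equality
  there.\<close>

lemma module_hom_sum:
  assumes N: "module K N" and f: "f \<in> module_hom K M N" and g: "g \<in> module_hom K M N"
  shows "(\<lambda>x. f x \<oplus>\<^bsub>N\<^esub> g x) \<in> module_hom K M N"
proof -
  interpret N: module K N by (rule N)
  note cl = module_hom_closed[OF f] module_hom_closed[OF g]
  show ?thesis
    by (rule module_homI)
       (use cl in \<open>simp_all add: module_hom_simps[OF f] module_hom_simps[OF g]
          N.smult_r_distr N.M.a_ac\<close>)
qed

lemma module_hom_scale:
  assumes N: "module K N" and f: "f \<in> module_hom K M N" and c: "c \<in> carrier K"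
  shows "(\<lambda>x. c \<odot>\<^bsub>N\<^esub> f x) \<in> module_hom K M N"
proof -
  interpret N: module K N by (rule N)
  show ?thesis
    by (rule module_homI)
       (use c in \<open>simp_all add: module_hom_simps[OF f] N.smult_r_distr
          N.smult_assoc1[symmetric] N.R.m_comm\<close>)
qed

text \<open>Bilinearity is encoded through the two families of partial maps, so that bilinear maps
  can be built by composing homomorphisms with \<open>module_hom_comp\<close>.\<close>

definition bilinear_map ::
  "('k, 'r) ring_scheme \<Rightarrow> ('k, 'm, 'x) module_scheme \<Rightarrow> ('k, 'n, 'y) module_scheme
    \<Rightarrow> ('k, 'p, 'z) module_scheme \<Rightarrow> ('m \<Rightarrow> 'n \<Rightarrow> 'p) \<Rightarrow> bool" where
  "bilinear_map K M N P \<beta> \<longleftrightarrow>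
     (\<forall>x\<in>carrier M. \<beta> x \<in> module_hom K N P) \<and>
     (\<forall>y\<in>carrier N. (\<lambda>x. \<beta> x y) \<in> module_hom K M P)"

context
  fixes K :: "('k, 'r) ring_scheme" and M :: "('k, 'm, 'x) module_scheme"
    and N :: "('k, 'n, 'y) module_scheme" and P :: "('k, 'p, 'z) module_scheme"
  assumes M: "module K M" and N: "module K N" and P: "module K P"
begin

text \<open>The universal property of the tensor product, with its five closure and linearity
  conditions on \<beta> bundled into \<open>bilinear_map\<close>.\<close>

lemma bilinear_lift:
  assumes "bilinear_map K M N P \<beta>"
  shows bilinear_lift_hom: "tensor_lift K P \<beta> \<in> module_hom K (tensor_product K M N) P"
    and bilinear_lift_pure: "x \<in> carrier M \<Longrightarrow> y \<in> carrier N \<Longrightarrow>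
          tensor_lift K P \<beta> (pure_tensor K M N x y) = \<beta> x y"
proof -
  have L: "\<beta> x \<in> module_hom K N P" if "x \<in> carrier M" for x
    using assms that by (simp add: bilinear_map_def)
  have R: "(\<lambda>x. \<beta> x y) \<in> module_hom K M P" if "y \<in> carrier N" for y
    using assms that by (simp add: bilinear_map_def)
  note facts = module_hom_closed[OF L] module_hom_add[OF R] module_hom_add[OF L]
    module_hom_smult[OF R] module_hom_smult[OF L]
  show "tensor_lift K P \<beta> \<in> module_hom K (tensor_product K M N) P"
    by (rule tensor_lift_hom[OF M N P]) (simp_all add: facts)
  show "tensor_lift K P \<beta> (pure_tensor K M N x y) = \<beta> x y"
    if "x \<in> carrier M" "y \<in> carrier N"
    by (rule tensor_lift_pure[OF M N P _ _ _ _ _ that]) (simp_all add: facts)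
qed

text \<open>Meant for the associativity maps, which are nested lifts: the outer lift requires the
  inner one to be linear in its parameter. For fixed parameters both sides of each identity are
  linear in \<open>t\<close>, and on pure tensors they agree by linearity of \<open>\<gamma>\<close>
  in \<open>u\<close>.\<close>

lemma tensor_lift_param_hom:
  assumes bil: "\<And>u. u \<in> carrier L \<Longrightarrow> bilinear_map K M N P (\<gamma> u)"
    and lin: "\<And>x y. x \<in> carrier M \<Longrightarrow> y \<in> carrier N \<Longrightarrow> (\<lambda>u. \<gamma> u x y) \<in> module_hom K L P"
    and L: "module K L"
    and t: "t \<in> carrier (tensor_product K M N)"
  shows "(\<lambda>u. tensor_lift K P (\<gamma> u) t) \<in> module_hom K L P"
proof (rule module_homI)
  interpret L: module K L by (rule L)
  note hom = bilinear_lift_hom[OF bil] and pure = bilinear_lift_pure[OF bil]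
  fix u assume u: "u \<in> carrier L"
  show "tensor_lift K P (\<gamma> u) t \<in> carrier P"
    by (rule module_hom_closed[OF hom[OF u] t])
  show "tensor_lift K P (\<gamma> (u \<oplus>\<^bsub>L\<^esub> v)) t =
      tensor_lift K P (\<gamma> u) t \<oplus>\<^bsub>P\<^esub> tensor_lift K P (\<gamma> v) t" if v: "v \<in> carrier L" for v
    by (rule tensor_hom_eqI[OF M N P _ _ _ t])
       (simp_all add: hom pure module_hom_sum[OF P] u v module_hom_add[OF lin])
  show "tensor_lift K P (\<gamma> (c \<odot>\<^bsub>L\<^esub> u)) t = c \<odot>\<^bsub>P\<^esub> tensor_lift K P (\<gamma> u) t"
    if c: "c \<in> carrier K" for c
    by (rule tensor_hom_eqI[OF M N P _ _ _ t])
       (simp_all add: hom pure module_hom_scale[OF P] u c module_hom_smult[OF lin])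
qed

end

lemma pure_tensor_hom:
  assumes M: "module K M" and N: "module K N"
  shows "x \<in> carrier M \<Longrightarrow> pure_tensor K M N x \<in> module_hom K N (tensor_product K M N)"
    and "y \<in> carrier N \<Longrightarrow> (\<lambda>x. pure_tensor K M N x y) \<in> module_hom K M (tensor_product K M N)"
  by (auto intro!: module_homI simp: pure_tensor_closed[OF M N] pure_tensor_bilinear[OF M N])

section \<open>Functoriality and associativity\<close>

context
  fixes K :: "('k, 'r) ring_scheme" and M :: "('k, 'm, 'x) module_scheme"
    and N :: "('k, 'n, 'y) module_scheme"
    and P :: "('k, 'p, 'z) module_scheme" and Q :: "('k, 'q, 'w) module_scheme"
    and f :: "'m \<Rightarrow> 'p" and g :: "'n \<Rightarrow> 'q"
  assumes M: "module K M" and N: "module K N" and P: "module K P" and Q: "module K Q"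
    and f: "f \<in> module_hom K M P" and g: "g \<in> module_hom K N Q"
begin

text \<open>The partial maps are \<open>g\<close> followed by tensoring with \<open>f x\<close> on
  the left, and \<open>f\<close> followed by tensoring with \<open>g y\<close> on the right.\<close>

private lemma map_bilinear:
  "bilinear_map K M N (tensor_product K P Q) (\<lambda>x y. pure_tensor K P Q (f x) (g y))"
  using module_hom_comp[OF g pure_tensor_hom(1)[OF P Q module_hom_closed[OF f]]]
    module_hom_comp[OF f pure_tensor_hom(2)[OF P Q module_hom_closed[OF g]]]
  by (auto simp: bilinear_map_def comp_def)

lemma tensor_map_hom:
  "tensor_map K P Q f g \<in> module_hom K (tensor_product K M N) (tensor_product K P Q)"
  unfolding tensor_map_def
  by (rule bilinear_lift_hom[OF M N tensor_product_module[OF P Q] map_bilinear])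

lemma tensor_map_pure:
  "x \<in> carrier M \<Longrightarrow> y \<in> carrier N \<Longrightarrow>
    tensor_map K P Q f g (pure_tensor K M N x y) = pure_tensor K P Q (f x) (g y)"
  unfolding tensor_map_def
  by (rule bilinear_lift_pure[OF M N tensor_product_module[OF P Q] map_bilinear])

end

text \<open>Both sides are linear and send a pure tensor of \<open>x\<close> and \<open>y\<close> to
  the pure tensor of \<open>f' (f x)\<close> and \<open>g' (g y)\<close>. This is the law that moves
  twists across \<mu> and \<Delta>.\<close>

lemma tensor_map_comp:
  assumes mods: "module K M" "module K N" "module K P" "module K Q" "module K U" "module K V"
    and f: "f \<in> module_hom K M P" "f' \<in> module_hom K P U"
    and g: "g \<in> module_hom K N Q" "g' \<in> module_hom K Q V"
    and t: "t \<in> carrier (tensor_product K M N)"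
  shows "tensor_map K U V (f' \<circ> f) (g' \<circ> g) t = tensor_map K U V f' g' (tensor_map K P Q f g t)"
proof -
  note fg = module_hom_comp[OF f] module_hom_comp[OF g]
  have "tensor_map K U V (f' \<circ> f) (g' \<circ> g) t = (tensor_map K U V f' g' \<circ> tensor_map K P Q f g) t"
  proof (rule tensor_hom_eqI[OF mods(1,2) tensor_product_module[OF mods(5,6)] _ _ _ t])
    show "tensor_map K U V (f' \<circ> f) (g' \<circ> g)
        \<in> module_hom K (tensor_product K M N) (tensor_product K U V)"
      by (rule tensor_map_hom[OF mods(1,2,5,6) fg])
    show "tensor_map K U V f' g' \<circ> tensor_map K P Q f g
        \<in> module_hom K (tensor_product K M N) (tensor_product K U V)"
      by (rule module_hom_comp[OF tensor_map_hom[OF mods(1-4) f(1) g(1)]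
            tensor_map_hom[OF mods(3-6) f(2) g(2)]])
  qed (simp add: tensor_map_pure[OF mods(1,2,5,6) fg, unfolded comp_def] comp_def tensor_map_pure[OF mods(1-4) f(1) g(1)]
      tensor_map_pure[OF mods(3-6) f(2) g(2)] module_hom_closed[OF f(1)] module_hom_closed[OF g(1)])
  then show ?thesis by simp
qed

context
  fixes K :: "('k, 'r) ring_scheme" and M :: "('k, 'm, 'x) module_scheme"
    and N :: "('k, 'n, 'y) module_scheme" and P :: "('k, 'p, 'z) module_scheme"
  assumes M: "module K M" and N: "module K N" and P: "module K P"
begin

text \<open>The inner lift is linear in the tensor by the universal property and in \<open>x\<close>
  by \<open>tensor_lift_param_hom\<close>, so the outer lift applies. Linearity supplies the carrier
  membership of rebracketed tensors.\<close>

lemma tensor_assoc_left_hom: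
  "tensor_assoc_left K M N P \<in>
     module_hom K (tensor_product K M (tensor_product K N P))
       (tensor_product K (tensor_product K M N) P)"
proof -
  let ?MN = "tensor_product K M N" and ?NP = "tensor_product K N P"
  let ?T = "tensor_product K ?MN P"
  let ?\<gamma> = "\<lambda>x y z. pure_tensor K ?MN P (pure_tensor K M N x y) z"
  note MN = tensor_product_module[OF M N] and NP = tensor_product_module[OF N P]
  note T = tensor_product_module[OF MN P]
  \<comment> \<open>Appending a fixed \<open>z\<close> is linear on \<open>?MN\<close>; composing
    with either partial map of \<open>pure_tensor K M N\<close> yields linearity in \<open>y\<close>
    and in \<open>x\<close>.\<close>
  have outer: "(\<lambda>s. pure_tensor K ?MN P s z) \<in> module_hom K ?MN ?T" if "z \<in> carrier P" for z
    by (rule pure_tensor_hom(2)[OF MN P that])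
  have bil: "bilinear_map K N P ?T (?\<gamma> x)" if x: "x \<in> carrier M" for x
    using pure_tensor_hom(1)[OF MN P pure_tensor_closed[OF M N x]]
      module_hom_comp[OF pure_tensor_hom(1)[OF M N x] outer]
    by (auto simp: bilinear_map_def comp_def)
  have lin: "(\<lambda>x. ?\<gamma> x y z) \<in> module_hom K M ?T" if "y \<in> carrier N" "z \<in> carrier P" for y z
    using module_hom_comp[OF pure_tensor_hom(2)[OF M N that(1)] outer[OF that(2)]]
    by (simp add: comp_def)
  have "bilinear_map K M ?NP ?T (\<lambda>x t. tensor_lift K ?T (?\<gamma> x) t)"
    using bilinear_lift_hom[OF N P T bil] tensor_lift_param_hom[OF N P T bil lin M]
    by (auto simp: bilinear_map_def)
  then show ?thesis
    unfolding tensor_assoc_left_def Let_def by (rule bilinear_lift_hom[OF M NP T])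
qed

text \<open>Mirror image of the previous argument: the last factor \<open>z\<close> is now the
  parameter of the inner lift.\<close>

lemma tensor_assoc_right_hom:
  "tensor_assoc_right K M N P \<in>
     module_hom K (tensor_product K (tensor_product K M N) P)
       (tensor_product K M (tensor_product K N P))"
proof -
  let ?MN = "tensor_product K M N" and ?NP = "tensor_product K N P"
  let ?T = "tensor_product K M ?NP"
  let ?\<gamma> = "\<lambda>z x y. pure_tensor K M ?NP x (pure_tensor K N P y z)"
  note MN = tensor_product_module[OF M N] and NP = tensor_product_module[OF N P]
  note T = tensor_product_module[OF M NP]
  have outer: "pure_tensor K M ?NP x \<in> module_hom K ?NP ?T" if "x \<in> carrier M" for x
    by (rule pure_tensor_hom(1)[OF M NP that])
  have bil: "bilinear_map K M N ?T (?\<gamma> z)" if z: "z \<in> carrier P" for z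
    using pure_tensor_hom(2)[OF M NP pure_tensor_closed[OF N P _ z]]
      module_hom_comp[OF pure_tensor_hom(2)[OF N P z] outer]
    by (auto simp: bilinear_map_def comp_def)
  have lin: "(\<lambda>z. ?\<gamma> z x y) \<in> module_hom K P ?T" if "x \<in> carrier M" "y \<in> carrier N" for x y
    using module_hom_comp[OF pure_tensor_hom(1)[OF N P that(2)] outer[OF that(1)]]
    by (simp add: comp_def)
  have "bilinear_map K ?MN P ?T (\<lambda>t z. tensor_lift K ?T (?\<gamma> z) t)"
    using bilinear_lift_hom[OF M N T bil] tensor_lift_param_hom[OF M N T bil lin P]
    by (auto simp: bilinear_map_def)
  then show ?thesis
    unfolding tensor_assoc_right_def Let_def by (rule bilinear_lift_hom[OF MN P T])
qed

end

section \<open>The twisting construction\<close>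

theorem theorem2p8:
  fixes K :: "('k, 'r) ring_scheme" and A :: "('k, 'a, 'm) module_scheme"
    and \<mu> :: "('k, 'a, 'a) tensor \<Rightarrow> 'a" and \<Delta> :: "'a \<Rightarrow> ('k, 'a, 'a) tensor"
    and \<alpha> :: "'a \<Rightarrow> 'a"
  assumes "field K"
    and "\<And>n::nat. n > 0 \<Longrightarrow> [n] \<cdot>\<^bsub>K\<^esub> \<one>\<^bsub>K\<^esub> \<noteq> \<zero>\<^bsub>K\<^esub>"
    and "infinitesimal_bialgebra K A \<mu> \<Delta>"
    and "infinitesimal_bialgebra_morphism K A \<mu> \<Delta> A \<mu> \<Delta> \<alpha>"
  shows "infinitesimal_hom_bialgebra K A (\<alpha> \<circ> \<mu>) (\<Delta> \<circ> \<alpha>) \<alpha>"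
proof -
  interpret B: infinitesimal_bialgebra K A \<mu> \<Delta> by (rule assms(3))
  interpret H: infinitesimal_bialgebra_morphism K A \<mu> \<Delta> A \<mu> \<Delta> \<alpha> by (rule assms(4))
  let ?A2 = "tensor_product K A A"
  let ?\<alpha>2 = "tensor_map K A A \<alpha> \<alpha>"
  let ?L = "tensor_assoc_left K A A A" and ?R = "tensor_assoc_right K A A A"
  have A: "module K A" by (rule B.module_axioms)
  note A2 = tensor_product_module[OF A A]
  note \<alpha> = H.linear and \<mu> = B.mult_linear and \<Delta> = B.comult_linear and id = module_hom_id[of K A]
  note \<alpha>2 = tensor_map_hom[OF A A A A \<alpha> \<alpha>]
  \<comment> \<open>Every axiom and factorisation below is conditional on carrier membership; these
    facts cover all intermediate tensors.\<close>
  note closed = module_hom_closed[OF \<alpha>] module_hom_closed[OF \<mu>] module_hom_closed[OF \<Delta>]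
    module_hom_closed[OF \<alpha>2]
    module_hom_closed[OF tensor_map_hom[OF A A2 A A id \<mu>]]
    module_hom_closed[OF tensor_map_hom[OF A2 A A A \<mu> id]]
    module_hom_closed[OF tensor_map_hom[OF A A A A2 id \<Delta>]]
    module_hom_closed[OF tensor_map_hom[OF A A A2 A \<Delta> id]]
    module_hom_closed[OF tensor_assoc_left_hom[OF A A A]]
    module_hom_closed[OF tensor_assoc_right_hom[OF A A A]]
  \<comment> \<open>The multiplication is applied before the twist, so \<alpha> is the outer map in
    both slots; \<open>\<alpha> \<circ> id\<close> collapses to \<alpha>.\<close>
  have mult_right: "tensor_map K A A \<alpha> (\<alpha> \<circ> \<mu>) t = ?\<alpha>2 (tensor_map K A A id \<mu> t)"
    if "t \<in> carrier (tensor_product K A ?A2)" for t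
    using tensor_map_comp[OF A A2 A A A A id \<alpha> \<mu> \<alpha> that] by simp
  have mult_left: "tensor_map K A A (\<alpha> \<circ> \<mu>) \<alpha> t = ?\<alpha>2 (tensor_map K A A \<mu> id t)"
    if "t \<in> carrier (tensor_product K ?A2 A)" for t
    using tensor_map_comp[OF A2 A A A A A \<mu> \<alpha> id \<alpha> that] by simp
  \<comment> \<open>Here the order is reversed: \<alpha> acts before \<Delta>, so it is the inner
    map in both slots.\<close>
  have comult_right: "tensor_map K A ?A2 \<alpha> (\<Delta> \<circ> \<alpha>) t = tensor_map K A ?A2 id \<Delta> (?\<alpha>2 t)"
    if "t \<in> carrier ?A2" for t
    using tensor_map_comp[OF A A A A A A2 \<alpha> id \<alpha> \<Delta> that] by simp
  have comult_left: "tensor_map K ?A2 A (\<Delta> \<circ> \<alpha>) \<alpha> t = tensor_map K ?A2 A \<Delta> id (?\<alpha>2 t)"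
    if "t \<in> carrier ?A2" for t
    using tensor_map_comp[OF A A A A A2 A \<alpha> \<Delta> \<alpha> id that] by simp
  show ?thesis
  \<comment> \<open>The vector space conditions come from the interpretations; linearity of the
    three maps and five identities remain.\<close>
  proof unfold_locales
    show "\<alpha> \<circ> \<mu> \<in> module_hom K ?A2 A" by (rule module_hom_comp[OF \<mu> \<alpha>])
    show "\<Delta> \<circ> \<alpha> \<in> module_hom K A ?A2" by (rule module_hom_comp[OF \<alpha> \<Delta>])
    show "\<alpha> \<in> module_hom K A A" by (fact \<alpha>)
  next
    fix t assume t: "t \<in> carrier ?A2"
    show "\<alpha> ((\<alpha> \<circ> \<mu>) t) = (\<alpha> \<circ> \<mu>) (?\<alpha>2 t)" by (simp add: H.mult t)
  next
    fix t assume t: "t \<in> carrier (tensor_product K A ?A2)"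
    \<comment> \<open>The \<open>?\<alpha>2\<close> released by \<open>mult_right\<close> passes
      through \<mu> as a second \<alpha>, so both sides become \<alpha> applied twice to the two
      sides of ordinary associativity, which is \<open>B.hom_assoc\<close> with twist
      \<open>id\<close>.\<close>
    have "(\<alpha> \<circ> \<mu>) (tensor_map K A A \<alpha> (\<alpha> \<circ> \<mu>) t) = \<alpha> (\<alpha> (\<mu> (tensor_map K A A id \<mu> t)))"
      using t by (simp add: mult_right H.mult closed)
    also have "\<dots> = \<alpha> (\<alpha> (\<mu> (tensor_map K A A \<mu> id (?L t))))"
      by (simp only: B.hom_assoc[OF t])
    also have "\<dots> = (\<alpha> \<circ> \<mu>) (tensor_map K A A (\<alpha> \<circ> \<mu>) \<alpha> (?L t))"
      using t by (simp add: mult_left H.mult closed)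
    finally show "(\<alpha> \<circ> \<mu>) (tensor_map K A A \<alpha> (\<alpha> \<circ> \<mu>) t) =
        (\<alpha> \<circ> \<mu>) (tensor_map K A A (\<alpha> \<circ> \<mu>) \<alpha> (?L t))" .
  next
    fix x assume x: "x \<in> carrier A"
    show "?\<alpha>2 ((\<Delta> \<circ> \<alpha>) x) = (\<Delta> \<circ> \<alpha>) (\<alpha> x)" using x by (simp add: H.comult closed)
  next
    fix x assume x: "x \<in> carrier A"
    \<comment> \<open>Coassociativity is used at this point: one \<alpha> comes from the first
      twisted comultiplication, the other from carrying the \<open>?\<alpha>2\<close> of
      \<open>comult_right\<close> back through \<Delta>.\<close>
    then have y: "\<alpha> (\<alpha> x) \<in> carrier A" by (simp add: closed)
    have "?L (tensor_map K A ?A2 \<alpha> (\<Delta> \<circ> \<alpha>) ((\<Delta> \<circ> \<alpha>) x)) =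
        ?L (tensor_map K A ?A2 id \<Delta> (\<Delta> (\<alpha> (\<alpha> x))))"
      using x by (simp add: comult_right H.comult[symmetric] closed)
    also have "\<dots> = tensor_map K ?A2 A \<Delta> id (\<Delta> (\<alpha> (\<alpha> x)))" by (rule B.hom_coassoc[OF y])
    also have "\<dots> = tensor_map K ?A2 A (\<Delta> \<circ> \<alpha>) \<alpha> ((\<Delta> \<circ> \<alpha>) x)"
      using x by (simp add: comult_left H.comult[symmetric] closed)
    finally show "?L (tensor_map K A ?A2 \<alpha> (\<Delta> \<circ> \<alpha>) ((\<Delta> \<circ> \<alpha>) x)) =
        tensor_map K ?A2 A (\<Delta> \<circ> \<alpha>) \<alpha> ((\<Delta> \<circ> \<alpha>) x)" .
  next
    fix t assume t: "t \<in> carrier ?A2"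
    \<comment> \<open>Of the two twists in the composite, the one next to \<mu> moves onto the
      argument, giving \<open>?s\<close>, and the other moves out past \<Delta>.\<close>
    let ?s = "?\<alpha>2 t"
    have s: "?s \<in> carrier ?A2" using t by (simp add: closed)
    have "(\<Delta> \<circ> \<alpha>) ((\<alpha> \<circ> \<mu>) t) = ?\<alpha>2 (\<Delta> (\<mu> ?s))"
      using t by (simp add: H.mult H.comult[symmetric] closed)
    also have "\<dots> = ?\<alpha>2 (tensor_map K A A \<mu> id (?L (tensor_map K A ?A2 id \<Delta> ?s))) \<oplus>\<^bsub>?A2\<^esub>
        ?\<alpha>2 (tensor_map K A A id \<mu> (?R (tensor_map K ?A2 A \<Delta> id ?s)))"
      using s by (simp only: B.comult_mult module_hom_add[OF \<alpha>2] closed)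
    \<comment> \<open>In each summand the outer \<open>?\<alpha>2\<close> is absorbed by the
      multiplication and the one inside \<open>?s\<close> by the comultiplication, on opposite sides
      of the rebracketing.\<close>
    also have "\<dots> =
        tensor_map K A A (\<alpha> \<circ> \<mu>) \<alpha> (?L (tensor_map K A ?A2 \<alpha> (\<Delta> \<circ> \<alpha>) t)) \<oplus>\<^bsub>?A2\<^esub>
        tensor_map K A A \<alpha> (\<alpha> \<circ> \<mu>) (?R (tensor_map K ?A2 A (\<Delta> \<circ> \<alpha>) \<alpha> t))"
      using t s by (simp add: mult_left mult_right comult_left comult_right closed)
    finally show "(\<Delta> \<circ> \<alpha>) ((\<alpha> \<circ> \<mu>) t) =
        tensor_map K A A (\<alpha> \<circ> \<mu>) \<alpha> (?L (tensor_map K A ?A2 \<alpha> (\<Delta> \<circ> \<alpha>) t)) \<oplus>\<^bsub>?A2\<^esub>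
        tensor_map K A A \<alpha> (\<alpha> \<circ> \<mu>) (?R (tensor_map K ?A2 A (\<Delta> \<circ> \<alpha>) \<alpha> t))" .
  qed
qed

end
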